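(* There exists a finite outerplanar $2$-tree $G$ such that $\chi_{cg}(G) = \mathrm{col}_{cg}(G) = 5$.
   Context: All graphs are finite. A $2$-tree is a graph that may be constructed by starting with a copy of $K_2$ and then iteratively adding new vertices of degree $2$ (at the time of addition) whose two neighbors are adjacent. A graph is outerplanar if it has a planar embedding in which every vertex lies on the boundary of the outer face. Connected coloring game. In the connected coloring game on a connected graph $G$ with a set of $m$ colors, two players, Alice and Bob, take turns, with Alice moving first; on each move the player chooses an uncolored vertex $v$ and colors it with one of the $m$ colors not already used on a neighbor of $v$, in such a way that the set of colored vertices always induces a connected subgraph of $G$ (so every move after the first is at a vertex adjacent to an already colored vertex). The game continues until all of $G$ is colored or there is no legal move. Alice wins if all of $G$ gets colored; Bob wins if a state is reached in which some vertex is uncolored but no move is legal. The connected game chromatic number $\chi_{cg}(G)$ is the minimum $m$ for which Alice has a winning strategy in the connected coloring game on $G$ with $m$ colors. Connected marking game. In the connected marking game on $G$, Alice and Bob take turns marking unmarked vertices of $G$ one at a time, with Alice marking first, until all vertices are marked; both players must play so that the set of marked vertices always induces a connected subgraph of $G$. The connected game coloring number $\mathrm{col}_{cg}(G)$ is the minimum integer $m$ for which Alice has a strategy guaranteeing that, at each game state, every unmarked vertex has at most $m-1$ marked neighbors. *)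

theory Defs
  imports "HOL-Analysis.Analysis"
begin

text \<open>A graph is given by a vertex set \<open>V\<close> and a set \<open>E\<close> of edges, each edge being the
  two-element set of its ends.\<close>

definition finite_simple_graph :: "'a set \<Rightarrow> 'a set set \<Rightarrow> bool" where
  "finite_simple_graph V E \<longleftrightarrow> finite V \<and> (\<forall>e\<in>E. e \<subseteq> V \<and> card e = 2)"

inductive two_tree :: "'a set \<Rightarrow> 'a set set \<Rightarrow> bool" where
  K2: "a \<noteq> b \<Longrightarrow> two_tree {a, b} {{a, b}}"
| add_vertex: "two_tree V E \<Longrightarrow> {u, w} \<in> E \<Longrightarrow> v \<notin> V \<Longrightarrow>
    two_tree (insert v V) (insert {v, u} (insert {v, w} E))"

lemma two_tree_imp_finite_simple_graph:
  "two_tree V E \<Longrightarrow> finite_simple_graph V E"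
proof (induction rule: two_tree.induct)
  case (K2 a b)
  then show ?case by (auto simp: finite_simple_graph_def)
next
  case (add_vertex V E u w v)
  then have "u \<in> V" "w \<in> V" "v \<noteq> u" "v \<noteq> w"
    by (auto simp: finite_simple_graph_def)
  with add_vertex.IH show ?case
    by (auto simp: finite_simple_graph_def)
qed


section \<open>Outerplanarity\<close>

text \<open>Vertices are placed at distinct points of the plane by \<open>p\<close>, and each edge \<open>e\<close> is drawn as
  the simple arc \<open>\<gamma> e\<close> joining its ends; arcs meet vertices and other arcs only at common ends.\<close>

definition planar_embedding ::
  "'a set \<Rightarrow> 'a set set \<Rightarrow> ('a \<Rightarrow> complex) \<Rightarrow> ('a set \<Rightarrow> real \<Rightarrow> complex) \<Rightarrow> bool" where
  "planar_embedding V E p \<gamma> \<longleftrightarrow>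
     inj_on p V \<and>
     (\<forall>e\<in>E. arc (\<gamma> e) \<and> {pathstart (\<gamma> e), pathfinish (\<gamma> e)} = p ` e) \<and>
     (\<forall>e\<in>E. path_image (\<gamma> e) \<inter> p ` V = p ` e) \<and>
     (\<forall>e\<in>E. \<forall>f\<in>E. e \<noteq> f \<longrightarrow> path_image (\<gamma> e) \<inter> path_image (\<gamma> f) = p ` (e \<inter> f))"

definition drawing ::
  "'a set \<Rightarrow> 'a set set \<Rightarrow> ('a \<Rightarrow> complex) \<Rightarrow> ('a set \<Rightarrow> real \<Rightarrow> complex) \<Rightarrow> complex set" where
  "drawing V E p \<gamma> = p ` V \<union> (\<Union>e\<in>E. path_image (\<gamma> e))"

text \<open>For a finite graph the drawing is compact, so \<^const>\<open>outside\<close> of it is the unique unbounded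
  component of its complement, i.e. the outer face.\<close>

definition outerplanar :: "'a set \<Rightarrow> 'a set set \<Rightarrow> bool" where
  "outerplanar V E \<longleftrightarrow>
     (\<exists>p \<gamma>. planar_embedding V E p \<gamma> \<and> p ` V \<subseteq> frontier (outside (drawing V E p \<gamma>)))"


section \<open>Two-player games, strategies\<close>

text \<open>A game state is the list of all moves made so far, the most recent one first. Alice moves first,
  hence it is her turn exactly when the number of moves made is even. A strategy for Alice tells
  her the next move as a function of the whole history; \<open>plays legal \<sigma>\<close> holds of the
  states that can be reached when Alice follows \<open>\<sigma>\<close> and Bob makes arbitrary legal moves.\<close>

inductive plays :: "('m list \<Rightarrow> 'm \<Rightarrow> bool) \<Rightarrow> ('m list \<Rightarrow> 'm) \<Rightarrow> 'm list \<Rightarrow> bool"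
  for legal :: "'m list \<Rightarrow> 'm \<Rightarrow> bool" and \<sigma> :: "'m list \<Rightarrow> 'm" where
  start: "plays legal \<sigma> []"
| alice: "plays legal \<sigma> h \<Longrightarrow> even (length h) \<Longrightarrow> legal h (\<sigma> h) \<Longrightarrow> plays legal \<sigma> (\<sigma> h # h)"
| bob: "plays legal \<sigma> h \<Longrightarrow> odd (length h) \<Longrightarrow> legal h x \<Longrightarrow> plays legal \<sigma> (x # h)"

text \<open>Alice may not pass or resign: her strategy has to supply a legal move at each of her turns
  at which one exists.\<close>

definition alice_strategy :: "('m list \<Rightarrow> 'm \<Rightarrow> bool) \<Rightarrow> ('m list \<Rightarrow> 'm) \<Rightarrow> bool" where
  "alice_strategy legal \<sigma> \<longleftrightarrow>
     (\<forall>h. plays legal \<sigma> h \<and> even (length h) \<and> (\<exists>x. legal h x) \<longrightarrow> legal h (\<sigma> h))"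

definition alice_can_guarantee :: "('m list \<Rightarrow> 'm \<Rightarrow> bool) \<Rightarrow> ('m list \<Rightarrow> bool) \<Rightarrow> bool" where
  "alice_can_guarantee legal P \<longleftrightarrow>
     (\<exists>\<sigma>. alice_strategy legal \<sigma> \<and> (\<forall>h. plays legal \<sigma> h \<longrightarrow> P h))"

definition induces_connected :: "'a set set \<Rightarrow> 'a set \<Rightarrow> bool" where
  "induces_connected E S \<longleftrightarrow>
     (\<forall>u\<in>S. \<forall>v\<in>S. (u, v) \<in> {(x, y). x \<in> S \<and> y \<in> S \<and> {x, y} \<in> E}\<^sup>*)"


section \<open>The connected coloring game\<close>

text \<open>A move \<open>(v, c)\<close> gives the vertex \<open>v\<close> the color \<open>c\<close>, one of \<open>0, \<dots>, m - 1\<close>.\<close>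

definition colored :: "('a \<times> nat) list \<Rightarrow> 'a set" where
  "colored h = fst ` set h"

definition legal_coloring ::
  "'a set \<Rightarrow> 'a set set \<Rightarrow> nat \<Rightarrow> ('a \<times> nat) list \<Rightarrow> 'a \<times> nat \<Rightarrow> bool" where
  "legal_coloring V E m h = (\<lambda>(v, c).
     v \<in> V - colored h \<and> c < m \<and> (\<forall>u. {u, v} \<in> E \<longrightarrow> (u, c) \<notin> set h) \<and>
     induces_connected E (insert v (colored h)))"

text \<open>Play stops only in a state without legal moves, and after at most \<open>card V\<close> moves. So Alice wins iff
  no state is reached in which some vertex is uncolored but no move is legal.\<close>

definition alice_wins_coloring :: "'a set \<Rightarrow> 'a set set \<Rightarrow> nat \<Rightarrow> bool" where
  "alice_wins_coloring V E m \<longleftrightarrow>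
     alice_can_guarantee (legal_coloring V E m)
       (\<lambda>h. (\<exists>x. legal_coloring V E m h x) \<or> colored h = V)"

definition chi_cg :: "'a set \<Rightarrow> 'a set set \<Rightarrow> nat" where
  "chi_cg V E = (LEAST m. alice_wins_coloring V E m)"


section \<open>The connected marking game\<close>

definition legal_marking :: "'a set \<Rightarrow> 'a set set \<Rightarrow> 'a list \<Rightarrow> 'a \<Rightarrow> bool" where
  "legal_marking V E h v \<longleftrightarrow> v \<in> V - set h \<and> induces_connected E (insert v (set h))"

text \<open>At most \<open>m - 1\<close> marked neighbors is expressed as fewer than \<open>m\<close>, as subtraction on
  \<^typ>\<open>nat\<close> truncates. Restricting \<open>m\<close> to natural numbers loses nothing for nonempty \<open>V\<close>: the
  initial state already excludes every \<open>m \<le> 0\<close>.\<close>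

definition alice_bounds_marking :: "'a set \<Rightarrow> 'a set set \<Rightarrow> nat \<Rightarrow> bool" where
  "alice_bounds_marking V E m \<longleftrightarrow>
     alice_can_guarantee (legal_marking V E)
       (\<lambda>h. \<forall>v\<in>V - set h. card {u \<in> set h. {u, v} \<in> E} < m)"

definition col_cg :: "'a set \<Rightarrow> 'a set set \<Rightarrow> nat" where
  "col_cg V E = (LEAST m. alice_bounds_marking V E m)"

end

theory Submission
  imports Defs
begin

text \<open>The graph is a long fan, a hub joined to all vertices of a path (the rim), with a further vertex
  of degree 2 (an ear) on every edge of the path.

  In the marking game Alice takes the hub first. Whenever Bob marks an ear, she marks the end of its
  rim edge that is still unmarked, if there is one. So after her moves an unmarked rim vertex has no
  marked ear, hence at most the hub and two rim vertices as marked neighbours; Bob's move adds one.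
  Colouring greedily along a strategy for the marking game with bound 5 wins with five colours.

  In the game with four colours Bob wins once the hub is coloured and he is to move with a gap of
  exactly three uncoloured vertices between two coloured rim vertices. He colours the middle one with
  the colour missing on the hub and on both ends of the gap. Then the two vertices next to it see
  three colours each, the ears allow him to add the fourth, and Alice can save only one of them.
  Forcing moves reduce longer gaps to this case. In a long untouched stretch Bob
  creates a gap of eight, which Alice cannot destroy with a single move.\<close>

section \<open>Connected vertex sets\<close>

lemma induces_connected_empty [simp]: "induces_connected E {}"
  by (simp add: induces_connected_def)

lemma induces_connected_insert:
  assumes S: "induces_connected E S" and u: "u \<in> S" and e: "{u, v} \<in> E"
  shows "induces_connected E (insert v S)"
proof -
  let ?R = "\<lambda>S. {(x, y). x \<in> S \<and> y \<in> S \<and> {x, y} \<in> E}"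
  have sub: "?R S \<subseteq> ?R (insert v S)" by auto
  have old: "(x, y) \<in> (?R (insert v S))\<^sup>*" if "x \<in> S" "y \<in> S" for x y
    using S that rtrancl_mono[OF sub] unfolding induces_connected_def by blast
  have uv: "(u, v) \<in> ?R (insert v S)" and vu: "(v, u) \<in> ?R (insert v S)"
    using u e by (auto simp: insert_commute)
  have to: "(x, v) \<in> (?R (insert v S))\<^sup>*" if "x \<in> S" for x
    using old[OF that u] uv by (rule rtrancl_into_rtrancl)
  have from_v: "(v, x) \<in> (?R (insert v S))\<^sup>*" if "x \<in> S" for x
    using vu old[OF u that] by (rule converse_rtrancl_into_rtrancl)
  show ?thesis
    unfolding induces_connected_def using old to from_v by auto
qed

lemma induces_connected_neighbour:
  assumes "induces_connected E S" "u \<in> S" "v \<in> S" "u \<noteq> v"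
  obtains w where "w \<in> S" "{w, v} \<in> E"
proof -
  have "(u, v) \<in> {(x, y). x \<in> S \<and> y \<in> S \<and> {x, y} \<in> E}\<^sup>*"
    using assms unfolding induces_connected_def by blast
  then show ?thesis
    using assms(4) that by (cases rule: rtrancl.cases) auto
qed

text \<open>A path in \<open>V\<close> from \<open>S\<close> to a vertex outside it leaves
  \<open>S\<close> along some edge, whose outer end can be added. Hence the marking game cannot halt
  before \<open>V\<close> is exhausted.\<close>

lemma induces_connected_extend:
  assumes V: "induces_connected E V" and S: "induces_connected E S" and "S \<subset> V"
  obtains v where "v \<in> V - S" "induces_connected E (insert v S)"
proof (cases "S = {}")
  case True
  then obtain v where "v \<in> V" using assms(3) by auto
  moreover have "induces_connected E {v}" by (auto simp: induces_connected_def)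
  ultimately show ?thesis using that True by auto
next
  case False
  then obtain u w where u: "u \<in> S" and w: "w \<in> V" "w \<notin> S" using assms(3) by auto
  have "(u, w) \<in> {(x, y). x \<in> V \<and> y \<in> V \<and> {x, y} \<in> E}\<^sup>*"
    using V u w assms(3) unfolding induces_connected_def by blast
  then have "w \<in> S \<or> (\<exists>x y. x \<in> S \<and> y \<in> V - S \<and> {x, y} \<in> E)"
    by (induction rule: rtrancl_induct) (use u in auto)
  then show ?thesis using w induces_connected_insert[OF S] that by blast
qed

lemma two_tree_connected: "two_tree V E \<Longrightarrow> induces_connected E V"
proof (induction rule: two_tree.induct)
  case (K2 a b)
  have "induces_connected {{a, b}} {a}" by (auto simp: induces_connected_def)
  then show ?case
    using induces_connected_insert[of "{{a, b}}" "{a}" a b] by (simp add: insert_commute)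
next
  case (add_vertex V E u w v)
  let ?E = "insert {v, u} (insert {v, w} E)"
  have "induces_connected ?E V"
    using add_vertex.IH rtrancl_mono[of "{(x, y). x \<in> V \<and> y \<in> V \<and> {x, y} \<in> E}"
        "{(x, y). x \<in> V \<and> y \<in> V \<and> {x, y} \<in> ?E}"]
    unfolding induces_connected_def by blast
  moreover have "u \<in> V"
    using two_tree_imp_finite_simple_graph[OF add_vertex.hyps(1)] add_vertex.hyps(2)
    by (auto simp: finite_simple_graph_def)
  ultimately show ?case
    by (rule induces_connected_insert) (simp add: insert_commute)
qed


section \<open>Strategies\<close>

text \<open>\<open>I\<close> describes the states with Alice to move and \<open>J\<close> those with
  Bob to move. The strategy picks any legal move that establishes \<open>J\<close>.\<close>

lemma alice_can_guarantee_invariant: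
  assumes start: "I []"
    and alice: "\<And>h. I h \<Longrightarrow> even (length h) \<Longrightarrow> \<exists>x. legal h x \<Longrightarrow> \<exists>x. legal h x \<and> J (x # h)"
    and bob: "\<And>h x. J h \<Longrightarrow> odd (length h) \<Longrightarrow> legal h x \<Longrightarrow> I (x # h)"
    and IP: "\<And>h. I h \<Longrightarrow> P h" and JP: "\<And>h. J h \<Longrightarrow> P h"
  shows "alice_can_guarantee legal P"
proof -
  define \<sigma> where "\<sigma> h = (SOME x. legal h x \<and> J (x # h))" for h
  have \<sigma>: "legal h (\<sigma> h) \<and> J (\<sigma> h # h)" if "I h" "even (length h)" "\<exists>x. legal h x" for h
    unfolding \<sigma>_def by (rule someI_ex) (rule alice[OF that])
  have inv: "if even (length h) then I h else J h" if "plays legal \<sigma> h" for h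
    using that
  proof (induction rule: plays.induct)
    case start
    then show ?case using \<open>I []\<close> by simp
  next
    case (alice h)
    then show ?case using \<sigma>[of h] by auto
  next
    case (bob h x)
    then show ?case using assms(3)[of h x] by simp
  qed
  show ?thesis
    unfolding alice_can_guarantee_def alice_strategy_def
    using \<sigma> inv IP JP by (metis (full_types))
qed

lemma colored_Nil [simp]: "colored [] = {}"
  by (simp add: colored_def)

lemma colored_Cons [simp]: "colored (x # h) = insert (fst x) (colored h)"
  by (simp add: colored_def)

lemma colored_iff: "v \<in> colored h \<longleftrightarrow> (\<exists>k. (v, k) \<in> set h)"
  by (force simp: colored_def)

lemma legal_marking_if_legal_coloring:
  "legal_coloring V E m h (v, k) \<Longrightarrow> legal_marking V E (map fst h) v"
  by (simp add: legal_coloring_def legal_marking_def colored_def)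

lemma plays_marking_connected:
  "plays (legal_marking V E) \<sigma> h \<Longrightarrow> induces_connected E (set h)"
  by (induction rule: plays.induct) (auto simp: legal_marking_def induces_connected_def)

lemma plays_marking_subset:
  "plays (legal_marking V E) \<sigma> h \<Longrightarrow> set h \<subseteq> V"
  by (induction rule: plays.induct) (auto simp: legal_marking_def)

text \<open>First-fit colouring along a strategy for the marking game.\<close>

lemma alice_wins_coloring_if_bounds_marking:
  assumes conn: "induces_connected E V" and mark: "alice_bounds_marking V E m"
  shows "alice_wins_coloring V E m"
proof -
  let ?M = "legal_marking V E" and ?C = "legal_coloring V E m"
  obtain \<sigma> where \<sigma>: "alice_strategy ?M \<sigma>"
    and bd: "\<And>h. plays ?M \<sigma> h \<Longrightarrow> \<forall>v\<in>V - set h. card {u \<in> set h. {u, v} \<in> E} < m"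
    using mark unfolding alice_bounds_marking_def alice_can_guarantee_def by blast
  \<comment> \<open>\<open>\<tau>\<close> takes the vertex that \<open>\<sigma>\<close> marks, with
    any colour legal for it.\<close>
  define \<tau> where "\<tau> h = (\<sigma> (map fst h), SOME k. ?C h (\<sigma> (map fst h), k))"
    for h :: "('a \<times> nat) list"
  have free: "\<exists>k. ?C h (v, k)" if "plays ?M \<sigma> (map fst h)" "?M (map fst h) v" for h v
  proof -
    let ?N = "{u \<in> colored h. {u, v} \<in> E}"
    \<comment> \<open>The forbidden colours at \<open>v\<close> lie in the image of its coloured
      neighbours under the colour map, so the marking bound leaves a colour.\<close>
    define K where "K = {k. \<exists>u. {u, v} \<in> E \<and> (u, k) \<in> set h}"
    have "distinct (map fst h)"
      using that(1) by (induction "map fst h" arbitrary: h rule: plays.induct)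
        (auto simp: legal_marking_def map_eq_Cons_conv)
    then have un: "k = k'" if "(u, k) \<in> set h" "(u, k') \<in> set h" for u k k'
      using that by (meson eq_key_imp_eq_value)
    have "K \<subseteq> (\<lambda>u. THE k. (u, k) \<in> set h) ` ?N"
    proof
      fix k assume "k \<in> K"
      then obtain u where u: "{u, v} \<in> E" "(u, k) \<in> set h" by (auto simp: K_def)
      then have "(THE k. (u, k) \<in> set h) = k" using un by (intro the_equality) auto
      then show "k \<in> (\<lambda>u. THE k. (u, k) \<in> set h) ` ?N"
        using u by (force simp: colored_iff)
    qed
    moreover have fin: "finite ?N" by (simp add: colored_def)
    ultimately have "card K \<le> card ?N" by (rule surj_card_le[rotated])
    moreover have "card ?N < m"
      using bd[OF that(1)] that(2) by (simp add: colored_def legal_marking_def)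
    ultimately have "card K < card {..<m}" by simp
    moreover have "finite K"
      using \<open>K \<subseteq> _\<close> fin by (meson finite_imageI finite_subset)
    ultimately have "\<not> {..<m} \<subseteq> K" using card_mono leD by blast
    then obtain k where "k < m" "k \<notin> K" by auto
    then have "?C h (v, k)"
      using that(2) by (auto simp: legal_coloring_def legal_marking_def K_def colored_def)
    then show ?thesis ..
  qed
  have sim: "plays ?M \<sigma> (map fst h)" if "plays ?C \<tau> h" for h
    using that
  proof (induction rule: plays.induct)
    case start
    show ?case by (simp add: plays.start)
  next
    case (alice h)
    have "fst (\<tau> h) = \<sigma> (map fst h)" by (simp add: \<tau>_def)
    moreover have "?M (map fst h) (fst (\<tau> h))"
      using alice.hyps(3) legal_marking_if_legal_coloring by (metis prod.collapse)
    ultimately show ?case using plays.alice[OF alice.IH] alice.hyps(2) by simp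
  next
    case (bob h x)
    have "?M (map fst h) (fst x)"
      using bob.hyps(3) legal_marking_if_legal_coloring by (metis prod.collapse)
    then show ?case using plays.bob[OF bob.IH] bob.hyps(2) by simp
  qed
  have "alice_strategy ?C \<tau>"
    unfolding alice_strategy_def
  proof (intro allI impI, elim conjE)
    fix h assume h: "plays ?C \<tau> h" "even (length h)" "\<exists>x. ?C h x"
    from h(3) obtain x where "?C h x" ..
    then have "?M (map fst h) (fst x)"
      using legal_marking_if_legal_coloring by (metis prod.collapse)
    then have "?M (map fst h) (\<sigma> (map fst h))"
      using \<sigma> sim[OF h(1)] h(2) unfolding alice_strategy_def by force
    then have "\<exists>k. ?C h (\<sigma> (map fst h), k)" by (rule free[OF sim[OF h(1)]])
    then show "?C h (\<tau> h)" unfolding \<tau>_def by (rule someI_ex)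
  qed
  moreover have "(\<exists>x. ?C h x) \<or> colored h = V" if h: "plays ?C \<tau> h" for h
  proof (cases "colored h = V")
    case False
    note ph = sim[OF h]
    have "colored h \<subset> V" "induces_connected E (colored h)"
      using plays_marking_subset[OF ph] plays_marking_connected[OF ph] False
      by (auto simp: colored_def)
    then obtain v where "v \<in> V - colored h" "induces_connected E (insert v (colored h))"
      using induces_connected_extend[OF conn] by blast
    then have "?M (map fst h) v" by (simp add: legal_marking_def colored_def)
    then show ?thesis using free[OF ph] by blast
  qed simp
  ultimately show ?thesis
    unfolding alice_wins_coloring_def alice_can_guarantee_def by blast
qed


section \<open>The fan with ears\<close>

text \<open>Vertex \<open>0\<close> is joined to all vertices of the path \<open>1, 3, 5, \<dots>, 2 * n + 1\<close>, and an ear with tip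
  \<open>2 * i + 2\<close> sits on the path edge from \<open>2 * i + 1\<close> to \<open>2 * i + 3\<close>. In this numbering
  \<open>0, 1, \<dots>, 2 * n + 1\<close> is the outer cycle.\<close>

definition fan_V :: "nat \<Rightarrow> nat set" where
  "fan_V n = {..2 * n + 1}"

definition fan_E :: "nat \<Rightarrow> nat set set" where
  "fan_E n = {{u, v} | u v. u < v \<and> v \<le> 2 * n + 1 \<and>
     (u = 0 \<and> odd v \<or> 0 < u \<and> v = u + 1 \<or> odd u \<and> v = u + 2)}"

lemma fan_E_iff:
  "{u, v} \<in> fan_E n \<longleftrightarrow> u \<le> 2 * n + 1 \<and> v \<le> 2 * n + 1 \<and>
     (u = 0 \<and> odd v \<or> v = 0 \<and> odd u \<or> 0 < u \<and> v = u + 1 \<or> 0 < v \<and> u = v + 1 \<or>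
      odd u \<and> v = u + 2 \<or> odd v \<and> u = v + 2)"
proof -
  let ?P = "\<lambda>u v. u < v \<and> v \<le> 2 * n + 1 \<and>
    (u = 0 \<and> odd v \<or> 0 < u \<and> v = u + 1 \<or> odd u \<and> v = u + 2)"
  have "{u, v} \<in> fan_E n \<longleftrightarrow> ?P u v \<or> ?P v u"
    unfolding fan_E_def by (auto simp: doubleton_eq_iff)
  then show ?thesis by (auto simp: odd_pos)
qed

lemma fan_E_cases:
  assumes "e \<in> fan_E n"
  obtains u v where "e = {u, v}" "u < v" "v \<le> 2 * n + 1"
    "u = 0 \<and> odd v \<or> 0 < u \<and> v = u + 1 \<or> odd u \<and> v = u + 2"
  using assms unfolding fan_E_def by blast

lemma fan_E_subset: "e \<in> fan_E n \<Longrightarrow> e \<subseteq> fan_V n"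
  by (erule fan_E_cases) (auto simp: fan_V_def)

text \<open>Passing from \<open>n\<close> to \<open>n + 1\<close> attaches the rim vertex
  \<open>2 * n + 3\<close> to the edge from the hub to \<open>2 * n + 1\<close>, and then the ear
  \<open>2 * n + 2\<close> to the new rim edge.\<close>

lemma two_tree_fan: "two_tree (fan_V n) (fan_E n)"
proof (induction n)
  case 0
  have "fan_V 0 = {0, 1}" by (auto simp: fan_V_def)
  moreover have "fan_E 0 = {{0, 1}}"
  proof
    show "fan_E 0 \<subseteq> {{0, 1}}"
    proof
      fix e assume "e \<in> fan_E 0"
      then obtain u v :: nat where "e = {u, v}" "u < v" "v \<le> 1"
        by (auto elim!: fan_E_cases)
      then have "u = 0" "v = 1" by auto
      then show "e \<in> {{0, 1}}" using \<open>e = _\<close> by simp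
    qed
    show "{{0, 1}} \<subseteq> fan_E 0" by (simp add: fan_E_iff)
  qed
  ultimately show ?case using two_tree.K2[of "0::nat" 1] by simp
next
  case (Suc n)
  let ?c = "2 * n + 3" and ?f = "2 * n + 2"
  let ?E = "insert {?c, 0} (insert {?c, 2 * n + 1} (fan_E n))"
  have "two_tree (insert ?c (fan_V n)) ?E"
    by (rule two_tree.add_vertex[OF Suc.IH]) (auto simp: fan_E_iff fan_V_def)
  then have "two_tree (insert ?f (insert ?c (fan_V n)))
      (insert {?f, ?c} (insert {?f, 2 * n + 1} ?E))"
    by (rule two_tree.add_vertex) (auto simp: fan_V_def)
  moreover have "insert ?f (insert ?c (fan_V n)) = fan_V (Suc n)"
    by (auto simp: fan_V_def)
  moreover have "insert {?f, ?c} (insert {?f, 2 * n + 1} ?E) = fan_E (Suc n)" (is "?L = ?R")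
  proof
    show "?L \<subseteq> ?R"
      by (auto simp: fan_E_iff elim!: fan_E_cases)
    show "?R \<subseteq> ?L"
    proof
      fix e assume "e \<in> ?R"
      then obtain u v where e: "e = {u, v}" "u < v" "v \<le> 2 * n + 3"
        "u = 0 \<and> odd v \<or> 0 < u \<and> v = u + 1 \<or> odd u \<and> v = u + 2"
        by (auto elim!: fan_E_cases)
      consider "v \<le> 2 * n + 1" | "v = ?f" | "v = ?c" using e(3) by linarith
      then show "e \<in> ?L"
      proof cases
        case 1
        then have "e \<in> fan_E n" using e unfolding fan_E_def by blast
        then show ?thesis by blast
      next
        case 2
        then have "u = 2 * n + 1" using e(4) by auto
        then show ?thesis using 2 e(1) by (simp add: insert_commute)
      next
        case 3
        then have "u = 0 \<or> u = ?f \<or> u = 2 * n + 1" using e(4) by auto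
        then show ?thesis using 3 e(1) by (auto simp: insert_commute)
      qed
    qed
  qed
  ultimately show ?case by simp
qed


section \<open>Outerplanarity of the fan with ears\<close>

text \<open>The vertices are placed on a parabola, in their cyclic order, and all edges are drawn as chords.\<close>

definition parabola :: "nat \<Rightarrow> complex" where
  "parabola k = Complex (real k) ((real k)\<^sup>2)"

definition chord :: "nat set \<Rightarrow> real \<Rightarrow> complex" where
  "chord e = linepath (parabola (Min e)) (parabola (Max e))"

lemma inj_parabola: "inj parabola"
  by (simp add: inj_def parabola_def)

lemma chord_pair: "u < v \<Longrightarrow> chord {u, v} = linepath (parabola u) (parabola v)"
  by (simp add: chord_def min_def max_def)

text \<open>The height of a chord above the parabola is the product of the horizontal distances to
  its two ends. It is nonnegative and vanishes only at the ends, which decides all later questions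
  about chords.\<close>

lemma chord_image:
  assumes "u < v" "z \<in> path_image (chord {u, v})"
  shows "real u \<le> Re z" "Re z \<le> real v" "Im z - (Re z)\<^sup>2 = (Re z - real u) * (real v - Re z)"
proof -
  obtain t where t: "0 \<le> t" "t \<le> 1" and z: "z = (1 - t) *\<^sub>R parabola u + t *\<^sub>R parabola v"
    using assms by (auto simp: chord_pair closed_segment_def)
  have re: "Re z = real u + t * (real v - real u)"
    by (simp add: z parabola_def algebra_simps)
  show "real u \<le> Re z" using t assms(1) by (simp add: re)
  have "t * (real v - real u) \<le> 1 * (real v - real u)"
    using t assms(1) by (intro mult_right_mono) auto
  then show "Re z \<le> real v" by (simp add: re)
  show "Im z - (Re z)\<^sup>2 = (Re z - real u) * (real v - Re z)"
    unfolding re by (simp add: z parabola_def power2_eq_square algebra_simps)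
qed

lemma parabola_eqI: "Re z = real k \<Longrightarrow> Im z = (Re z)\<^sup>2 \<Longrightarrow> z = parabola k"
  by (simp add: parabola_def complex_eq_iff)

text \<open>The outer chord minus the inner one has height
  \<open>(w - u) * (v - r) + (r - w) * (v - x)\<close> at abscissa \<open>r\<close>. Both terms are
  nonnegative, so they vanish where the chords meet.\<close>

lemma chords_meet_nested:
  assumes uv: "u < v" and wx: "w < x" and ne: "(u, v) \<noteq> (w, x)" and nest: "u \<le> w" "x \<le> v"
    and z: "z \<in> path_image (chord {u, v})" "z \<in> path_image (chord {w, x})"
  shows "z \<in> parabola ` ({u, v} \<inter> {w, x})"
proof -
  define r where "r = Re z"
  note a = chord_image[OF uv z(1), folded r_def] and b = chord_image[OF wx z(2), folded r_def]
  have eq: "(r - real u) * (real v - r) = (r - real w) * (real x - r)"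
    using a b by simp
  have "(real w - real u) * (real v - r) + (r - real w) * (real v - real x) = 0"
    using eq by (simp add: algebra_simps)
  moreover have "0 \<le> (real w - real u) * (real v - r)" "0 \<le> (r - real w) * (real v - real x)"
    using a b nest by (auto intro!: mult_nonneg_nonneg)
  ultimately have "(real w - real u) * (real v - r) = 0" "(r - real w) * (real v - real x) = 0"
    by linarith+
  \<comment> \<open>Of the four combinations, \<open>w = u\<close> with \<open>v = x\<close> would
    make the chords equal, and \<open>r = v = w\<close> contradicts \<open>w < x\<close> and
    \<open>x \<le> v\<close>.\<close>
  then have "(w = u \<or> r = real v) \<and> (r = real w \<or> v = x)" by auto
  then have "(r = real v \<and> v = x) \<or> (r = real w \<and> w = u)"
    using ne b nest wx by auto
  then show ?thesis
  proof (elim disjE conjE)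
    assume "r = real v" "v = x"
    then have "z = parabola v" using a(3) by (intro parabola_eqI) (auto simp: r_def)
    then show ?thesis using \<open>v = x\<close> by auto
  next
    assume "r = real w" "w = u"
    then have "z = parabola w" using b(3) by (intro parabola_eqI) (auto simp: r_def)
    then show ?thesis using \<open>w = u\<close> by auto
  qed
qed

text \<open>The chords lie over intervals that share at most the point \<open>v = w\<close>.\<close>

lemma chords_meet_apart:
  assumes uv: "u < v" and wx: "w < x" and apart: "v \<le> w"
    and z: "z \<in> path_image (chord {u, v})" "z \<in> path_image (chord {w, x})"
  shows "z \<in> parabola ` ({u, v} \<inter> {w, x})"
proof -
  note a = chord_image[OF uv z(1)] and b = chord_image[OF wx z(2)]
  have "Re z = real v" "v = w" using a b apart by linarith+
  moreover from this have "z = parabola v" using a(3) by (intro parabola_eqI) auto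
  ultimately show ?thesis by auto
qed

lemma fan_chords_meet:
  assumes "e \<in> fan_E n" "f \<in> fan_E n" "e \<noteq> f"
    and z: "z \<in> path_image (chord e)" "z \<in> path_image (chord f)"
  shows "z \<in> parabola ` (e \<inter> f)"
proof -
  obtain u v where e: "e = {u, v}" "u < v"
    and uv: "u = 0 \<and> odd v \<or> 0 < u \<and> v = u + 1 \<or> odd u \<and> v = u + 2"
    using assms(1) by (blast elim: fan_E_cases)
  obtain w x where f: "f = {w, x}" "w < x"
    and wx: "w = 0 \<and> odd x \<or> 0 < w \<and> x = w + 1 \<or> odd w \<and> x = w + 2"
    using assms(2) by (blast elim: fan_E_cases)
  have ne: "(u, v) \<noteq> (w, x)" using assms(3) e f by auto
  \<comment> \<open>If two edges interleaved, the one with the larger first end would avoid the hub.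
    The only vertex strictly between the ends of such an edge is an ear tip, and the tip is adjacent
    to these two ends only.\<close>
  have "\<not> (u < w \<and> w < v \<and> v < x)" "\<not> (w < u \<and> u < x \<and> x < v)"
    using uv wx by (elim disjE conjE; presburger)+
  then consider "v \<le> w" | "x \<le> u" | "u \<le> w" "x \<le> v" | "w \<le> u" "v \<le> x"
    by linarith
  then show ?thesis
  proof cases
    case 1
    then show ?thesis using chords_meet_apart[of u v w x z] e f z by simp
  next
    case 2
    then show ?thesis using chords_meet_apart[of w x u v z] e f z by (simp add: Int_commute)
  next
    case 3
    then show ?thesis using chords_meet_nested[of u v w x z] ne e f z by simp
  next
    case 4
    then show ?thesis using chords_meet_nested[of w x u v z] ne e f z by (auto simp: Int_commute)
  qed
qed

lemma planar_embedding_fan: "planar_embedding (fan_V n) (fan_E n) parabola chord"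
proof -
  have pq: "parabola u \<noteq> parabola v" if "u \<noteq> v" for u v
    using inj_parabola that by (auto dest: injD)
  have arc: "arc (chord e) \<and> {pathstart (chord e), pathfinish (chord e)} = parabola ` e"
    if "e \<in> fan_E n" for e
    using that by (rule fan_E_cases) (auto simp: chord_pair pq)
  have ends: "parabola ` e \<subseteq> path_image (chord e)" if "e \<in> fan_E n" for e
    unfolding conjunct2[OF arc[OF that], symmetric]
    by (simp add: pathstart_in_path_image pathfinish_in_path_image)
  have verts: "path_image (chord e) \<inter> parabola ` fan_V n = parabola ` e" if "e \<in> fan_E n" for e
  proof (intro equalityI subsetI)
    fix z assume "z \<in> path_image (chord e) \<inter> parabola ` fan_V n"
    then obtain k where k: "z = parabola k" and z: "z \<in> path_image (chord e)" by auto
    obtain u v where e: "e = {u, v}" "u < v" using \<open>e \<in> fan_E n\<close> by (blast elim: fan_E_cases)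
    have "(real k - real u) * (real v - real k) = 0"
      using chord_image(3)[of u v z] z e by (simp add: k parabola_def)
    then have "k \<in> e" by (auto simp: e)
    then show "z \<in> parabola ` e" by (simp add: k)
  qed (use ends[OF that] fan_E_subset[OF that] in auto)
  have "path_image (chord e) \<inter> path_image (chord f) = parabola ` (e \<inter> f)"
    if "e \<in> fan_E n" "f \<in> fan_E n" "e \<noteq> f" for e f
    using fan_chords_meet[OF that] ends[OF that(1)] ends[OF that(2)] by blast
  then show ?thesis
    unfolding planar_embedding_def using arc verts inj_parabola by (auto intro: inj_on_subset)
qed

text \<open>The vertical ray going down from \<open>z\<close> misses \<open>D\<close> and is
  unbounded.\<close>

lemma below_parabola_outside:
  assumes D: "\<And>z. z \<in> D \<Longrightarrow> (Re z)\<^sup>2 \<le> Im z" and z: "Im z < (Re z)\<^sup>2"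
  shows "z \<in> outside D"
proof -
  let ?g = "\<lambda>t. Complex (Re z) (Im z - t)"
  let ?R = "?g ` {0..}"
  have "continuous_on {0..} ?g"
    unfolding Complex_eq by (intro continuous_intros)
  then have "connected ?R"
    by (rule connected_continuous_image) (simp add: convex_connected)
  moreover have "?R \<subseteq> - D" using D z by force
  moreover have "z \<in> ?R" by (rule image_eqI[of _ _ 0]) (auto simp: complex_eq_iff)
  ultimately have sub: "?R \<subseteq> connected_component_set (- D) z"
    by (simp add: connected_component_maximal)
  have "\<not> bounded ?R"
  proof
    assume "bounded ?R"
    then obtain B where "B > 0" and B: "\<And>w. w \<in> ?R \<Longrightarrow> cmod w \<le> B"
      by (auto simp: bounded_pos)
    have "\<bar>Im (?g (\<bar>Im z\<bar> + B + 1))\<bar> \<le> B"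
      using \<open>B > 0\<close> by (intro order_trans[OF abs_Im_le_cmod] B imageI) auto
    then show False by simp
  qed
  then show ?thesis
    using bounded_subset[OF _ sub] \<open>?R \<subseteq> - D\<close> \<open>z \<in> ?R\<close> by (auto simp: outside_def)
qed

text \<open>All chords lie on or above the parabola, so points just below a vertex belong to the
  outer face.\<close>

lemma outerplanar_fan: "outerplanar (fan_V n) (fan_E n)"
proof -
  let ?D = "drawing (fan_V n) (fan_E n) parabola chord"
  have D: "(Re z)\<^sup>2 \<le> Im z" if "z \<in> ?D" for z
  proof -
    from that consider k where "z = parabola k"
      | e where "e \<in> fan_E n" "z \<in> path_image (chord e)"
      by (auto simp: drawing_def)
    then show ?thesis
    proof cases
      case 1
      then show ?thesis by (simp add: parabola_def)
    next
      case 2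
      then obtain u v where "e = {u, v}" "u < v" by (blast elim: fan_E_cases)
      then have "Im z - (Re z)\<^sup>2 = (Re z - real u) * (real v - Re z)"
        "real u \<le> Re z" "Re z \<le> real v"
        using chord_image[of u v z] 2(2) by auto
      moreover from this have "0 \<le> (Re z - real u) * (real v - Re z)" by simp
      ultimately show ?thesis by linarith
    qed
  qed
  have "parabola k \<in> frontier (outside ?D)" if "k \<in> fan_V n" for k
  proof -
    have "parabola k \<in> ?D" using that by (auto simp: drawing_def)
    then have "parabola k \<notin> outside ?D" using outside_no_overlap by blast
    moreover have "parabola k \<in> closure (outside ?D)"
      unfolding closure_approachable
    proof (intro allI impI)
      fix \<epsilon> :: real assume "\<epsilon> > 0"
      let ?w = "parabola k - Complex 0 (\<epsilon> / 2)"
      have "?w \<in> outside ?D"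
        by (rule below_parabola_outside[OF D]) (use \<open>\<epsilon> > 0\<close> in \<open>auto simp: parabola_def\<close>)
      moreover have "dist ?w (parabola k) < \<epsilon>"
        using \<open>\<epsilon> > 0\<close> by (simp add: dist_norm cmod_def)
      ultimately show "\<exists>y\<in>outside ?D. dist y (parabola k) < \<epsilon>" by blast
    qed
    ultimately show ?thesis using interior_subset by (auto simp: frontier_def)
  qed
  then show ?thesis
    unfolding outerplanar_def using planar_embedding_fan by blast
qed


section \<open>The marking game on the fan with ears\<close>

lemma alice_bounds_marking_fan: "alice_bounds_marking (fan_V n) (fan_E n) 5"
proof -
  let ?V = "fan_V n" and ?E = "fan_E n"
  let ?L = "legal_marking ?V ?E"
  \<comment> \<open>\<open>J\<close> holds after Alice's moves. \<open>I\<close> allows one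
    arbitrary move of Bob after \<open>J\<close>, which her reply has to repair.\<close>
  define J where "J h \<longleftrightarrow> 0 \<in> set h \<and> set h \<subseteq> ?V \<and> induces_connected ?E (set h) \<and>
    (\<forall>k \<in> set h. even k \<and> 0 < k \<longrightarrow> k - 1 \<in> set h \<and> k + 1 \<in> set h)" for h
  define I where "I h \<longleftrightarrow> h = [] \<or> (\<exists>x h'. h = x # h' \<and> J h' \<and> ?L h' x)" for h
  have nbrs: "card {u \<in> set h. {u, v} \<in> ?E} \<le> 3" if J: "J h" and v: "v \<notin> set h" for h v
  proof -
    \<comment> \<open>By \<open>J\<close> an unmarked rim vertex has no marked ear. For
      \<open>v = 1\<close> the truncated \<open>v - 2\<close> is the hub once more, which does no
      harm.\<close>
    have "{u \<in> set h. {u, v} \<in> ?E} \<subseteq> (if odd v then {0, v - 2, v + 2} else {v - 1, v + 1})"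
    proof
      fix u assume "u \<in> {u \<in> set h. {u, v} \<in> ?E}"
      then have u: "u \<in> set h" and e: "{u, v} \<in> ?E" by auto
      have "v \<noteq> 0" using J v by (auto simp: J_def intro: gr0I)
      have "odd u \<or> u = 0" if "odd v"
      proof (rule ccontr)
        assume "\<not> (odd u \<or> u = 0)"
        then have "u - 1 \<in> set h" "u + 1 \<in> set h" "v = u + 1 \<or> v = u - 1"
          using J u e by (auto simp: J_def fan_E_iff)
        then show False using v by auto
      qed
      then show "u \<in> (if odd v then {0, v - 2, v + 2} else {v - 1, v + 1})"
        using e \<open>v \<noteq> 0\<close> by (auto simp: fan_E_iff)
    qed
    then have "card {u \<in> set h. {u, v} \<in> ?E} \<le> card (if odd v then {0, v - 2, v + 2} else {v - 1, v + 1})"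
      by (rule card_mono[rotated]) auto
    also have "\<dots> \<le> 3" by (auto simp: card_insert_if)
    finally show ?thesis .
  qed
  have legal0: "?L h v" if "0 \<in> set h" "induces_connected ?E (set h)" "odd v" "v \<in> ?V - set h" for h v
    using induces_connected_insert[OF that(2,1), of v] that(3,4)
    by (auto simp: legal_marking_def fan_E_iff fan_V_def)
  have conn: "induces_connected ?E (insert x (set h))" if "?L h x" for h x
    using that by (simp add: legal_marking_def)
  show ?thesis
    unfolding alice_bounds_marking_def
  proof (rule alice_can_guarantee_invariant[where I = I and J = J])
    show "I []" by (simp add: I_def)
  next
    fix h x assume "J h" "?L h x"
    then show "I (x # h)" by (auto simp: I_def)
  next
    fix h assume "J h"
    then show "\<forall>v\<in>?V - set h. card {u \<in> set h. {u, v} \<in> ?E} < 5"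
      using nbrs by fastforce
  next
    fix h assume "I h"
    show "\<forall>v\<in>?V - set h. card {u \<in> set h. {u, v} \<in> ?E} < 5"
    proof
      fix v assume v: "v \<in> ?V - set h"
      show "card {u \<in> set h. {u, v} \<in> ?E} < 5"
      proof (cases "h = []")
        case False
        then obtain x h' where h: "h = x # h'" "J h'" using \<open>I h\<close> by (auto simp: I_def)
        have "card {u \<in> set h. {u, v} \<in> ?E} \<le> card (insert x {u \<in> set h'. {u, v} \<in> ?E})"
          by (rule card_mono) (auto simp: h)
        also have "\<dots> \<le> Suc (card {u \<in> set h'. {u, v} \<in> ?E})"
          by (simp add: card_insert_if)
        also have "\<dots> \<le> Suc 3" using nbrs[OF h(2)] v h(1) by simp
        finally show ?thesis by simp
      qed simp
    qed
  next
    fix h assume "I h" and ex: "\<exists>x. ?L h x"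
    show "\<exists>x. ?L h x \<and> J (x # h)"
    proof (cases "h = []")
      case True
      have "?L [] 0" by (simp add: legal_marking_def fan_V_def induces_connected_def)
      moreover have "J [0]" by (simp add: J_def fan_V_def induces_connected_def)
      ultimately show ?thesis using True by blast
    next
      case False
      then obtain x h' where h: "h = x # h'" and J: "J h'" and x: "?L h' x"
        using \<open>I h\<close> by (auto simp: I_def)
      have h0: "0 \<in> set h" and hc: "induces_connected ?E (set h)" and hV: "set h \<subseteq> ?V"
        using J conn[OF x] x by (auto simp: h J_def legal_marking_def)
      have reply: "?L h y \<and> J (y # h)"
        if y: "?L h y" and ok: "\<And>k. k \<in> insert y (set h) \<Longrightarrow> even k \<Longrightarrow> 0 < k \<Longrightarrow>
          k - 1 \<in> insert y (set h) \<and> k + 1 \<in> insert y (set h)" for y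
        using y ok h0 hV conn[OF y] by (simp add: J_def legal_marking_def)
      have old: "k - 1 \<in> set h \<and> k + 1 \<in> set h" if "k \<in> set h" "k \<noteq> x" "even k" "0 < k" for k
        using J that by (auto simp: J_def h)
      show ?thesis
      \<comment> \<open>Bob has just marked an ear \<open>x\<close> with an unmarked end
        \<open>y\<close>. As the marked set is connected and contains the hub, the other end is
        already marked, so marking \<open>y\<close> restores \<open>J\<close>.\<close>
      proof (cases "\<exists>y. y \<in> {x - 1, x + 1} - set h \<and> even x")
        case True
        then obtain y where y: "y \<in> {x - 1, x + 1}" "y \<notin> set h" and "even x" by blast
        have "x \<noteq> 0" using x J by (auto simp: legal_marking_def J_def intro: gr0I)
        have "x \<in> ?V" using x by (simp add: legal_marking_def)
        obtain w where "w \<in> set h" and w: "{w, x} \<in> ?E"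
          using induces_connected_neighbour[OF hc h0, of x] \<open>x \<noteq> 0\<close> h by auto
        have "w \<in> {x - 1, x + 1}" using w \<open>even x\<close> \<open>x \<noteq> 0\<close> by (auto simp: fan_E_iff)
        then have both: "x - 1 \<in> insert y (set h) \<and> x + 1 \<in> insert y (set h)"
          using y \<open>w \<in> set h\<close> by auto
        have "odd y" "y \<in> ?V"
          using y \<open>even x\<close> \<open>x \<noteq> 0\<close> \<open>x \<in> ?V\<close> by (auto simp: fan_V_def)
        then have "?L h y" using legal0[OF h0 hc] y(2) by simp
        then show ?thesis
          using reply[of y] both old \<open>odd y\<close> by (metis insert_iff)
      next
        case F: False
        then have ok: "k - 1 \<in> set h \<and> k + 1 \<in> set h" if "k \<in> set h" "even k" "0 < k" for k
          using old[of k] that by (cases "k = x") auto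
        show ?thesis
        \<comment> \<open>There is nothing to repair. An unmarked rim vertex is adjacent to the hub
          and safe to mark; if none is left, every remaining vertex is an ear with both ends
          marked.\<close>
        proof (cases "\<exists>y \<in> ?V - set h. odd y")
          case True
          then obtain y where "y \<in> ?V - set h" "odd y" by blast
          then show ?thesis using reply[of y] legal0[OF h0 hc] ok by (metis insert_iff)
        next
          case False
          from ex obtain y where y: "?L h y" ..
          then have "y \<in> ?V" "even y" using False by (auto simp: legal_marking_def)
          have "y - 1 \<in> set h \<and> y + 1 \<in> set h" if "0 < y"
          proof -
            have "odd (y - 1)" "odd (y + 1)" using \<open>even y\<close> that by auto
            moreover have "y + 1 \<le> 2 * n + 1"
              using \<open>y \<in> ?V\<close> \<open>even y\<close> unfolding fan_V_def by simp presburger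
            ultimately have "y - 1 \<in> {y \<in> ?V. odd y}" "y + 1 \<in> {y \<in> ?V. odd y}"
              by (auto simp: fan_V_def)
            then show ?thesis using False by blast
          qed
          then show ?thesis using reply[OF y] ok y by (metis insert_iff)
        qed
      qed
    qed
  qed
qed


section \<open>Playing against a winning strategy in the colouring game\<close>

lemma avoid_colors:
  assumes "length ks < m"
  obtains k :: nat where "k < m" "k \<notin> set ks"
proof -
  have "card (set ks) < card {..<m}" using assms card_length[of ks] by simp
  then have "\<not> {..<m} \<subseteq> set ks" using card_mono[of "set ks" "{..<m}"] by auto
  then show ?thesis using that by blast
qed

text \<open>A supposed winning strategy of Alice, against which Bob's moves are chosen until
  \<open>False\<close> is derived.\<close>

locale alice_winning =
  fixes V :: "'a set" and E :: "'a set set" and m :: nat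
    and \<sigma> :: "('a \<times> nat) list \<Rightarrow> 'a \<times> nat"
  assumes graph: "finite_simple_graph V E"
    and strategy: "alice_strategy (legal_coloring V E m) \<sigma>"
    and not_stuck: "plays (legal_coloring V E m) \<sigma> h \<Longrightarrow>
      (\<exists>x. legal_coloring V E m h x) \<or> colored h = V"
begin

abbreviation legal where "legal \<equiv> legal_coloring V E m"
abbreviation play where "play \<equiv> plays legal \<sigma>"

lemma edge_neq: "{u, v} \<in> E \<Longrightarrow> u \<noteq> v"
  using graph by (auto simp: finite_simple_graph_def)

lemma play_subset: "play h \<Longrightarrow> colored h \<subseteq> V"
  by (induction rule: plays.induct) (auto simp: legal_coloring_def)

lemma play_connected: "play h \<Longrightarrow> induces_connected E (colored h)"
  by (induction rule: plays.induct) (auto simp: legal_coloring_def)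

lemma play_distinct: "play h \<Longrightarrow> distinct (map fst h)"
  by (induction rule: plays.induct) (auto simp: legal_coloring_def colored_iff)

lemma play_unique: "play h \<Longrightarrow> (v, k) \<in> set h \<Longrightarrow> (v, k') \<in> set h \<Longrightarrow> k = k'"
  using play_distinct eq_key_imp_eq_value by metis

lemma play_color_less: "play h \<Longrightarrow> (v, k) \<in> set h \<Longrightarrow> k < m"
  by (induction rule: plays.induct) (auto simp: legal_coloring_def)

lemma play_proper:
  "play h \<Longrightarrow> {u, v} \<in> E \<Longrightarrow> (u, k) \<in> set h \<Longrightarrow> (v, k) \<notin> set h"
  by (induction rule: plays.induct)
    (auto simp: legal_coloring_def insert_commute dest: edge_neq)

lemma card_colored: "play h \<Longrightarrow> card (colored h) = length h"
  using play_distinct[of h] distinct_card[of "map fst h"] by (simp add: colored_def)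

lemma play_neighbour:
  assumes "play h" "u \<in> colored h" "v \<in> colored h" "u \<noteq> v"
  obtains w where "w \<in> colored h" "{w, v} \<in> E"
  using induces_connected_neighbour[OF play_connected] assms by metis

text \<open>A vertex seeing all colours stays uncoloured for ever, so the play gets stuck.\<close>

lemma free_color:
  assumes "play h" "v \<in> V" "v \<notin> colored h"
  obtains k where "k < m" "\<And>u. {u, v} \<in> E \<Longrightarrow> (u, k) \<notin> set h"
proof -
  have "\<exists>k<m. \<forall>u. {u, v} \<in> E \<longrightarrow> (u, k) \<notin> set h"
    using assms
  proof (induction "card V - length h" arbitrary: h rule: less_induct)
    case less
    have "finite V" using graph by (simp add: finite_simple_graph_def)
    moreover have "colored h \<subset> V" using less.prems play_subset by blast
    ultimately have "length h < card V"
      using card_colored[OF less.prems(1)] psubset_card_mono by metis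
    then have smaller: "card V - length (x # h) < card V - length h" for x by simp
    obtain x where x: "legal h x" "play (x # h)"
    proof (cases "even (length h)")
      case True
      have "\<exists>x. legal h x" using not_stuck[OF less.prems(1)] less.prems by blast
      then have "legal h (\<sigma> h)"
        using strategy True less.prems(1) by (simp add: alice_strategy_def)
      then show ?thesis using plays.alice[OF less.prems(1) True] that by blast
    next
      case False
      obtain x where "legal h x" using not_stuck[OF less.prems(1)] less.prems by blast
      then show ?thesis using plays.bob[OF less.prems(1) False] that by blast
    qed
    obtain w k where wk: "x = (w, k)" by (cases x)
    show ?case
    \<comment> \<open>The colour of a move at \<open>v\<close> was free there; after any other move
      the induction yields a colour, which was free before as well.\<close>
    proof (cases "w = v")
      case True
      then show ?thesis using x(1) wk by (auto simp: legal_coloring_def)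
    next
      case False
      then show ?thesis
        using less.hyps[OF smaller x(2)] less.prems wk by auto
    qed
  qed
  then show ?thesis using that by blast
qed

definition bobs_turn :: "('a \<times> nat) list \<Rightarrow> bool" where
  "bobs_turn h \<longleftrightarrow> play h \<and> odd (length h)"

lemma bobs_turn_play: "bobs_turn h \<Longrightarrow> play h"
  by (simp add: bobs_turn_def)

lemma bob_move:
  assumes "bobs_turn h" "v \<in> V" "v \<notin> colored h" "w \<in> colored h" "{w, v} \<in> E"
    and "k < m" "\<And>u. {u, v} \<in> E \<Longrightarrow> (u, k) \<notin> set h"
  shows "play ((v, k) # h)"
proof (rule plays.bob)
  show "legal h (v, k)"
    using assms induces_connected_insert[OF play_connected assms(4,5)]
    by (auto simp: legal_coloring_def bobs_turn_def)
qed (use assms(1) in \<open>auto simp: bobs_turn_def\<close>)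

text \<open>The vertex \<open>z\<close> shows that the game is not over after Bob's move, so Alice
  must reply.\<close>

lemma bob_round:
  assumes h: "bobs_turn h" and p: "play ((v, k) # h)"
    and z: "z \<in> V" "z \<notin> colored h" "z \<noteq> v"
  obtains y d where "legal ((v, k) # h) (y, d)" "bobs_turn ((y, d) # (v, k) # h)"
proof -
  let ?h = "(v, k) # h"
  have ev: "even (length ?h)" using h by (simp add: bobs_turn_def)
  have "\<exists>x. legal ?h x" using not_stuck[OF p] z by auto
  then have l: "legal ?h (\<sigma> ?h)" using strategy p ev unfolding alice_strategy_def by blast
  obtain y d where yd: "\<sigma> ?h = (y, d)" by (cases "\<sigma> ?h")
  then show ?thesis
    using that[of y d] plays.alice[OF p ev l] l ev by (simp add: bobs_turn_def)
qed

text \<open>Bob's final blow: \<open>v\<close> lacks only the colour \<open>k\<close> among its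
  neighbours, and Bob puts \<open>k\<close> on the neighbour \<open>u\<close>. This contradicts
  \<open>free_color\<close>.\<close>

lemma bob_kills:
  assumes h: "bobs_turn h" and v: "v \<in> V" "v \<notin> colored h"
    and u: "u \<in> V" "u \<notin> colored h" "{u, v} \<in> E"
    and w: "w \<in> colored h" "{w, u} \<in> E"
    and k: "k < m" "\<And>x. {x, u} \<in> E \<Longrightarrow> (x, k) \<notin> set h"
    and seen: "\<And>j. j < m \<Longrightarrow> j \<noteq> k \<Longrightarrow> \<exists>x. {x, v} \<in> E \<and> (x, j) \<in> set h"
  shows False
proof -
  have "play ((u, k) # h)" by (rule bob_move[OF h u(1,2) w k])
  moreover have "v \<notin> colored ((u, k) # h)" using v edge_neq[OF u(3)] by simp
  ultimately obtain j where j: "j < m" "\<And>x. {x, v} \<in> E \<Longrightarrow> (x, j) \<notin> set ((u, k) # h)"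
    using free_color v(1) by blast
  then show False using seen[of j] u(3) by (cases "j = k") auto
qed

end


section \<open>The colouring game on the fan with ears\<close>

text \<open>Index notation for the numbering: \<open>ear i\<close> sits on the edge from
  \<open>rim i\<close> to \<open>rim (i + 1)\<close>. Adjacency becomes a condition on indices,
  without parity.\<close>

definition rim :: "nat \<Rightarrow> nat" where "rim i = 2 * i + 1"
definition ear :: "nat \<Rightarrow> nat" where "ear i = 2 * i + 2"

lemma rim_ear_simps [simp]:
  "rim i = rim j \<longleftrightarrow> i = j" "ear i = ear j \<longleftrightarrow> i = j"
  "rim i \<noteq> ear j" "ear j \<noteq> rim i" "rim i \<noteq> 0" "0 \<noteq> rim i" "ear i \<noteq> 0" "0 \<noteq> ear i"
  unfolding rim_def ear_def by presburger+

lemma fan_V_simps [simp]: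
  "0 \<in> fan_V n" "rim i \<in> fan_V n \<longleftrightarrow> i \<le> n" "ear i \<in> fan_V n \<longleftrightarrow> i < n"
  by (auto simp: fan_V_def rim_def ear_def)

lemma fan_V_cases:
  assumes "v \<in> fan_V n"
  obtains "v = 0" | i where "v = rim i" "i \<le> n" | i where "v = ear i" "i < n"
proof -
  have "v = 0 \<or> v = rim (v div 2) \<or> v = ear (v div 2 - 1)"
    unfolding rim_def ear_def by presburger
  then show ?thesis using that assms by (metis fan_V_simps(2,3))
qed

lemma fan_E_simps [simp]:
  "{0, rim i} \<in> fan_E n \<longleftrightarrow> i \<le> n"
  "{rim i, 0} \<in> fan_E n \<longleftrightarrow> i \<le> n"
  "{rim i, rim j} \<in> fan_E n \<longleftrightarrow> i \<le> n \<and> j \<le> n \<and> (j = i + 1 \<or> i = j + 1)"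
  "{ear i, rim j} \<in> fan_E n \<longleftrightarrow> i < n \<and> (j = i \<or> j = i + 1)"
  "{rim j, ear i} \<in> fan_E n \<longleftrightarrow> i < n \<and> (j = i \<or> j = i + 1)"
  "{ear i, ear j} \<notin> fan_E n" "{0, ear i} \<notin> fan_E n" "{ear i, 0} \<notin> fan_E n"
  unfolding fan_E_iff rim_def ear_def by presburger+

lemma fan_E_vertex: "{u, v} \<in> fan_E n \<Longrightarrow> u \<in> fan_V n"
  using fan_E_subset by blast

lemma rim_neighbour_free:
  assumes "(0, k) \<notin> set h"
    and "\<And>j. j \<le> n \<Longrightarrow> j = i + 1 \<or> i = j + 1 \<Longrightarrow> (rim j, k) \<notin> set h"
    and "\<And>j. j < n \<Longrightarrow> j = i \<or> i = j + 1 \<Longrightarrow> (ear j, k) \<notin> set h"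
    and "{u, rim i} \<in> fan_E n"
  shows "(u, k) \<notin> set h"
  using fan_E_vertex[OF assms(4)] by (rule fan_V_cases) (use assms in auto)

lemma ear_neighbour_free:
  assumes "(rim i, k) \<notin> set h" "(rim (i + 1), k) \<notin> set h" "{u, ear i} \<in> fan_E n"
  shows "(u, k) \<notin> set h"
  using fan_E_vertex[OF assms(3)] by (rule fan_V_cases) (use assms in auto)

locale fan_game = alice_winning "fan_V n" "fan_E n" m \<sigma>
  for n m :: nat and \<sigma> :: "(nat \<times> nat) list \<Rightarrow> nat \<times> nat"
begin

text \<open>The coloured set is connected and contains the hub, so a coloured ear has a coloured
  neighbour, which is an end of its rim edge.\<close>

lemma ear_uncolored:
  assumes "play h" "0 \<in> colored h" "rim i \<notin> colored h" "rim (i + 1) \<notin> colored h"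
  shows "ear i \<notin> colored h"
proof
  assume "ear i \<in> colored h"
  then obtain w where w: "w \<in> colored h" "{w, ear i} \<in> fan_E n"
    using play_neighbour[OF assms(1,2)] by (metis rim_ear_simps(8))
  from fan_E_vertex[OF w(2)] show False
    by (rule fan_V_cases) (use w assms in auto)
qed

text \<open>With both rim neighbours uncoloured, the adjacent ears are uncoloured too. Only the
  colour of the hub is forbidden, and the hub keeps the move connected.\<close>

lemma bob_rim:
  assumes h: "bobs_turn h" and a: "(0, a) \<in> set h" and i: "i \<le> n" "rim i \<notin> colored h"
    and k: "k < m" "k \<noteq> a"
    and nb: "\<And>j. j \<le> n \<Longrightarrow> j = i + 1 \<or> i = j + 1 \<Longrightarrow> rim j \<notin> colored h"
  shows "play ((rim i, k) # h)"
proof (rule bob_move[OF h])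
  have a0: "0 \<in> colored h" using a by (auto simp: colored_iff)
  fix u assume "{u, rim i} \<in> fan_E n"
  then show "(u, k) \<notin> set h"
  proof (rule rim_neighbour_free[rotated 3])
    show "(0, k) \<notin> set h" using play_unique[OF bobs_turn_play[OF h]] a k(2) by blast
    fix j assume "j < n" and "j = i \<or> i = j + 1"
    then have "ear j \<notin> colored h"
      using ear_uncolored[OF bobs_turn_play[OF h] a0, of j] nb[of "i + 1"] nb[of j] i by auto
    then show "(ear j, k) \<notin> set h" by (auto simp: colored_iff)
  qed (use nb in \<open>auto simp: colored_iff\<close>)
qed (use assms in \<open>auto simp: colored_iff\<close>)

section \<open>A coloured hub and an untouched stretch of the rim\<close>

lemma reach_hub:
  assumes h: "bobs_turn h" and i: "i \<le> n" "rim i \<in> colored h" and len: "length h \<le> 3" "2 \<le> n"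
  obtains h' where "bobs_turn h'" "0 \<in> colored h'" "length h' \<le> 5"
proof (cases "0 \<in> colored h")
  case True
  then show ?thesis using that h len by force
next
  case False
  obtain k where k: "k < m" "\<And>u. {u, 0} \<in> fan_E n \<Longrightarrow> (u, k) \<notin> set h"
    using free_color[OF bobs_turn_play[OF h] _ False] by auto
  have p: "play ((0, k) # h)"
    using bob_move[OF h _ False i(2) _ k] i(1) by auto
  \<comment> \<open>At most four vertices are coloured after Bob's move and \<open>2 \<le> n\<close>
    gives at least six, so Alice has to reply.\<close>
  have "card (insert 0 (colored h)) < card (fan_V n)"
    using card_colored[OF bobs_turn_play[OF h]] len by (simp add: fan_V_def card_insert_if colored_def)
  then have "\<not> fan_V n \<subseteq> insert 0 (colored h)"
    using card_mono[of "insert 0 (colored h)" "fan_V n"] by (auto simp: colored_def)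
  then obtain z where "z \<in> fan_V n" "z \<notin> colored h" "z \<noteq> 0" by blast
  then obtain y d where "bobs_turn ((y, d) # (0, k) # h)"
    using bob_round[OF h p] by metis
  then show ?thesis using that len by force
qed

text \<open>If Alice starts at a rim vertex, Bob can colour the hub at once. If she starts at an
  ear, he first colours an end of its rim edge, which costs one more round.\<close>

lemma hub_reached:
  assumes "2 \<le> n"
  obtains h where "bobs_turn h" "0 \<in> colored h" "length h \<le> 5"
proof -
  have "\<exists>x. legal [] x" using not_stuck[OF plays.start] fan_V_simps(1)[of n] by fastforce
  then have l: "legal [] (\<sigma> [])"
    using strategy plays.start[of legal \<sigma>] unfolding alice_strategy_def by fastforce
  obtain x d where xd: "\<sigma> [] = (x, d)" by (cases "\<sigma> []")
  have h: "bobs_turn [(x, d)]"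
    using plays.alice[of legal \<sigma> "[]"] plays.start[of legal \<sigma>] l by (simp add: bobs_turn_def xd)
  have "x \<in> fan_V n" using l by (simp add: xd legal_coloring_def)
  then show ?thesis
  proof (cases rule: fan_V_cases)
    case 1
    then show ?thesis using that[OF h] by simp
  next
    case (2 i)
    then show ?thesis using reach_hub[OF h, of i] that assms by auto
  next
    case (3 i)
    have i: "rim i \<in> fan_V n" "rim i \<notin> colored [(x, d)]"
      using 3 by (auto simp: colored_def)
    obtain k where k: "k < m" "\<And>u. {u, rim i} \<in> fan_E n \<Longrightarrow> (u, k) \<notin> set [(x, d)]"
      using free_color[OF bobs_turn_play[OF h] i] by blast
    have p: "play ((rim i, k) # [(x, d)])"
      using bob_move[OF h i _ _ k, of x] 3 by auto
    obtain y e where "bobs_turn ((y, e) # (rim i, k) # [(x, d)])"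
      by (rule bob_round[OF h p, of 0]) (use 3 in \<open>auto simp: colored_def\<close>)
    then show ?thesis by (rule reach_hub[of _ i]) (use 3 assms that in auto)
  qed
qed

text \<open>The rim indices up to \<open>94 = 5 * 19 - 1\<close> form five blocks of 19. One of the
  at most five coloured vertices is the hub, so the others miss a block. Since a block spans 38
  numbers, \<open>v div 38\<close> is the block of \<open>v\<close>.\<close>

lemma untouched_block:
  assumes p: "play h" "0 \<in> colored h" "length h \<le> 5" and n: "94 \<le> n"
  obtains s where "s + 18 \<le> n" "\<And>i. s \<le> i \<Longrightarrow> i \<le> s + 18 \<Longrightarrow> rim i \<notin> colored h"
proof -
  let ?B = "(\<lambda>v. v div 38) ` (colored h - {0})"
  have fin: "finite (colored h)" by (simp add: colored_def)
  then have "card ?B \<le> card (colored h - {0})" by (intro card_image_le) auto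
  also have "\<dots> < 5" using p fin card_colored[OF p(1)] by simp
  finally have "\<not> {..<5} \<subseteq> ?B" using fin card_mono[of ?B "{..<5}"] by auto
  then obtain b where b: "b < 5" "b \<notin> ?B" by blast
  have "rim i \<notin> colored h" if "19 * b \<le> i" "i \<le> 19 * b + 18" for i
  proof
    assume "rim i \<in> colored h"
    moreover have "rim i div 38 = b" using that by (intro div_nat_eqI) (auto simp: rim_def)
    ultimately show False using b(2) by force
  qed
  then show ?thesis using that[of "19 * b"] b(1) n by simp
qed

text \<open>With at most three colours, a rim vertex between two differently coloured ones is lost.\<close>

lemma few_colors_lose:
  assumes m: "m \<le> 3" and n: "94 \<le> n"
  shows False
proof -
  obtain h where h: "bobs_turn h" "0 \<in> colored h" "length h \<le> 5"
    using hub_reached n by auto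
  obtain s where s: "s + 18 \<le> n" "\<And>i. s \<le> i \<Longrightarrow> i \<le> s + 18 \<Longrightarrow> rim i \<notin> colored h"
    using untouched_block[OF bobs_turn_play[OF h(1)] h(2,3) n] by blast
  obtain a where a: "(0, a) \<in> set h" using h(2) by (auto simp: colored_iff)
  have "rim (s + 9) \<notin> colored h" using s(2) by simp
  then obtain k where k: "k < m" "\<And>u. {u, rim (s + 9)} \<in> fan_E n \<Longrightarrow> (u, k) \<notin> set h"
    using free_color[OF bobs_turn_play[OF h(1)], of "rim (s + 9)"] s(1) by auto
  have "k \<noteq> a" using k(2)[of 0] a s(1) by auto
  have p: "play ((rim (s + 9), k) # h)"
  proof (rule bob_rim[OF h(1) a _ _ k(1) \<open>k \<noteq> a\<close>])
    show "rim j \<notin> colored h" if "j = s + 9 + 1 \<or> s + 9 = j + 1" for j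
      using that s(2)[of j] by auto
  qed (use s in auto)
  obtain y d where g: "bobs_turn ((y, d) # (rim (s + 9), k) # h)" (is "bobs_turn ?g")
    by (rule bob_round[OF h(1) p, of "rim s"]) (use s(1) s(2)[of s] in auto)
  \<comment> \<open>\<open>rim u\<close> is next to Bob's vertex and \<open>rim t\<close> one step
    further out, on a side where Alice's reply has left the nearby rim alone.\<close>
  obtain u t where ut: "u = s + 8 \<and> t = s + 7 \<or> u = s + 10 \<and> t = s + 11"
    and y: "y \<noteq> rim u" "y \<noteq> rim t" "\<And>j. j \<le> n \<Longrightarrow> j = t + 1 \<or> t = j + 1 \<Longrightarrow> y \<noteq> rim j"
  proof (cases "\<exists>i < s + 9. y = rim i")
    case True
    then show ?thesis by (intro that[of "s + 10" "s + 11"]) auto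
  next
    case False
    then have "y \<noteq> rim (s + 6)" "y \<noteq> rim (s + 7)" "y \<noteq> rim (s + 8)" by auto
    then show ?thesis by (intro that[of "s + 8" "s + 7"]) (auto simp: add.commute)
  qed
  have u: "rim u \<in> fan_V n" "rim u \<notin> colored ?g"
    using ut y(1) s(1) s(2)[of u] by auto
  \<comment> \<open>\<open>z\<close> is a colour still free at \<open>rim u\<close>. Bob spends it
    on \<open>rim t\<close>, so that \<open>rim u\<close> sees \<open>a\<close>, \<open>k\<close>
    and \<open>z\<close> and would need a fourth colour.\<close>
  obtain z where z: "z < m" "\<And>x. {x, rim u} \<in> fan_E n \<Longrightarrow> (x, z) \<notin> set ?g"
    using free_color[OF bobs_turn_play[OF g] u] by blast
  have "z \<noteq> a" using z(2)[of 0] a u by auto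
  have "z \<noteq> k" using z(2)[of "rim (s + 9)"] ut s(1) by auto
  have "play ((rim t, z) # ?g)"
  proof (rule bob_rim[OF g _ _ _ z(1) \<open>z \<noteq> a\<close>])
    show "rim t \<notin> colored ?g" using ut y(2) s(2)[of t] by auto
    fix j assume "j \<le> n" "j = t + 1 \<or> t = j + 1"
    then show "rim j \<notin> colored ?g" using ut y(3)[of j] s(2)[of j] by auto
  qed (use a ut s(1) in auto)
  moreover have "rim u \<notin> colored ((rim t, z) # ?g)" using u ut by auto
  ultimately obtain c where c: "c < m" "\<And>x. {x, rim u} \<in> fan_E n \<Longrightarrow> (x, c) \<notin> set ((rim t, z) # ?g)"
    using free_color u(1) by blast
  have "c \<noteq> a" "c \<noteq> k" "c \<noteq> z"
    using c(2)[of 0] c(2)[of "rim (s + 9)"] c(2)[of "rim t"] a u ut s(1) by auto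
  moreover have "a < m" using play_color_less[OF bobs_turn_play[OF h(1)] a] .
  ultimately show False using m k(1) z(1) c(1) \<open>z \<noteq> a\<close> \<open>z \<noteq> k\<close> \<open>k \<noteq> a\<close> by linarith
qed

end


section \<open>Four colours\<close>

lemma four_colors:
  fixes a b c d j :: nat
  assumes "distinct [a, b, c, d]" "a < 4" "b < 4" "c < 4" "d < 4" "j < 4"
  shows "j = a \<or> j = b \<or> j = c \<or> j = d"
proof -
  have "{a, b, c, d} = {..<4}"
    using assms by (intro card_subset_eq) auto
  then show ?thesis using assms(6) by blast
qed

locale fan_game_4 = fan_game n 4 \<sigma>
  for n :: nat and \<sigma> :: "(nat \<times> nat) list \<Rightarrow> nat \<times> nat"
begin

text \<open>\<open>rim i\<close> sees the three colours other than \<open>d\<close>. Bob puts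
  \<open>d\<close> on the ear over the edge from \<open>rim i\<close> to \<open>rim i'\<close>,
  which is legal as \<open>e \<noteq> d\<close>. The equation of pairs lets \<open>rim i\<close> be
  either end of that edge.\<close>

lemma bob_kills_ear:
  assumes h: "bobs_turn h" and i: "i \<le> n" "rim i \<notin> colored h"
    and abc: "(0, a) \<in> set h" "(p, b) \<in> set h" "{p, rim i} \<in> fan_E n"
      "(q, c) \<in> set h" "{q, rim i} \<in> fan_E n"
    and d: "distinct [a, b, c, d]" "d < 4"
    and j: "j < n" "ear j \<notin> colored h" "{i, i'} = {j, j + 1}" "(rim i', e) \<in> set h" "e \<noteq> d"
  shows False
proof (rule bob_kills[OF h, of "rim i" "ear j" "rim i'" d])
  note ph = bobs_turn_play[OF h]
  show "{ear j, rim i} \<in> fan_E n" "{rim i', ear j} \<in> fan_E n"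
    using j(1,3) by (auto simp: doubleton_eq_iff)
  fix x assume x: "{x, ear j} \<in> fan_E n"
  have "(rim i, d) \<notin> set h" using i(2) by (auto simp: colored_iff)
  moreover have "(rim i', d) \<notin> set h" using play_unique[OF ph] j(4,5) by blast
  ultimately show "(x, d) \<notin> set h"
    using ear_neighbour_free[OF _ _ x, of d h] j(3) by (auto simp: doubleton_eq_iff)
next
  fix k :: nat assume "k < 4" "k \<noteq> d"
  then have "k = a \<or> k = b \<or> k = c"
    using four_colors[OF d(1), of k] d(2) abc play_color_less[OF bobs_turn_play[OF h]] by blast
  then show "\<exists>x. {x, rim i} \<in> fan_E n \<and> (x, k) \<in> set h"
    using abc i(1) fan_E_simps(1) by blast
qed (use i j d in \<open>auto simp: colored_iff\<close>)

text \<open>Bob's reply in the middle makes both outer vertices see three colours at once.\<close>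

lemma gap_3:
  assumes h: "bobs_turn h" and a: "(0, a) \<in> set h" and s: "s + 4 \<le> n"
    and x: "(rim s, x) \<in> set h" and y: "(rim (s + 4), y) \<in> set h"
    and free: "rim (s + 1) \<notin> colored h" "rim (s + 2) \<notin> colored h" "rim (s + 3) \<notin> colored h"
  shows False
proof -
  note ph = bobs_turn_play[OF h]
  have "a \<noteq> x" "a \<noteq> y"
    using play_proper[OF ph, of 0 "rim s" a] play_proper[OF ph, of 0 "rim (s + 4)" a] a x y s
    by auto
  obtain z where z: "z < 4" "z \<notin> set [a, x, y]" by (rule avoid_colors[of "[a, x, y]" 4]) auto
  have p: "play ((rim (s + 2), z) # h)"
  proof (rule bob_rim[OF h a])
    show "rim j \<notin> colored h" if "j = s + 2 + 1 \<or> s + 2 = j + 1" for j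
      using that free by (auto simp: add.commute numeral_eq_Suc)
  qed (use z s free in auto)
  obtain v d where g: "bobs_turn ((v, d) # (rim (s + 2), z) # h)" (is "bobs_turn ?g")
    by (rule bob_round[OF h p, of "rim (s + 1)"]) (use free s in auto)
  have ears: "ear (s + 1) \<notin> colored h" "ear (s + 2) \<notin> colored h"
    using ear_uncolored[OF ph, of "s + 1"] ear_uncolored[OF ph, of "s + 2"] a free
    by (auto simp: colored_iff numeral_eq_Suc)
  show False
  \<comment> \<open>The two attacks use the ears on either side of \<open>rim (s + 2)\<close>. A
    reply at \<open>rim (s + 1)\<close> or \<open>ear (s + 1)\<close> leaves the right attack
    intact, any other reply the left one.\<close>
  proof (cases "v = rim (s + 1) \<or> v = ear (s + 1)")
    case True
    obtain w where w: "w < 4" "w \<notin> set [a, y, z]" by (rule avoid_colors[of "[a, y, z]" 4]) auto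
    show False
      by (rule bob_kills_ear[OF g, of "s + 3" a "rim (s + 4)" y "rim (s + 2)" z w "s + 2" "s + 2" z])
        (use True a y z w s free ears \<open>a \<noteq> y\<close> in auto)
  next
    case False
    obtain w where w: "w < 4" "w \<notin> set [a, x, z]" by (rule avoid_colors[of "[a, x, z]" 4]) auto
    show False
      by (rule bob_kills_ear[OF g, of "s + 1" a "rim s" x "rim (s + 2)" z w "s + 1" "s + 2" z])
        (use False a x z w s free ears \<open>a \<noteq> x\<close> in auto)
  qed
qed

text \<open>Here parity is against Bob; he corrects it with a move on the first ear, which threatens
  the vertex \<open>rim (s + 1)\<close>. Alice can only colour that vertex, leaving a gap of three, or take the
  missing colour \<open>w\<close> to \<open>rim (s + 3)\<close>, which exposes \<open>rim (s + 4)\<close> as \<open>w \<noteq> y\<close>.\<close>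

lemma gap_4:
  assumes h: "bobs_turn h" and a: "(0, a) \<in> set h" and s: "s + 5 \<le> n"
    and x: "(rim s, x) \<in> set h" and y: "(rim (s + 5), y) \<in> set h"
    and free: "rim (s + 1) \<notin> colored h" "rim (s + 2) \<notin> colored h" "rim (s + 3) \<notin> colored h"
      "rim (s + 4) \<notin> colored h" "ear s \<notin> colored h"
  shows False
proof -
  note ph = bobs_turn_play[OF h]
  have a0: "0 \<in> colored h" using a by (auto simp: colored_iff)
  have ax: "a \<noteq> x" and ay: "a \<noteq> y"
    using play_proper[OF ph, of 0 "rim s" a] play_proper[OF ph, of 0 "rim (s + 5)" a] a x y s
    by auto
  \<comment> \<open>Once \<open>z\<close> is on \<open>ear s\<close>, \<open>rim (s + 1)\<close>
    sees \<open>a\<close>, \<open>x\<close> and \<open>z\<close>, so that \<open>w\<close> is the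
    only colour left for it.\<close>
  obtain w where w: "w < 4" "w \<notin> set [a, x, y]" by (rule avoid_colors[of "[a, x, y]" 4]) auto
  obtain z where z: "z < 4" "z \<notin> set [a, x, w]" by (rule avoid_colors[of "[a, x, w]" 4]) auto
  have p: "play ((ear s, z) # h)"
  proof (rule bob_move[OF h])
    fix u assume "{u, ear s} \<in> fan_E n"
    then show "(u, z) \<notin> set h"
      by (rule ear_neighbour_free[rotated 2])
        (use z free(1) play_unique[OF ph x] in \<open>auto simp: colored_iff\<close>)
  qed (use x s z free in \<open>auto simp: colored_iff\<close>)
  obtain v d where g: "bobs_turn ((v, d) # (ear s, z) # h)" (is "bobs_turn ?g")
    by (rule bob_round[OF h p, of "rim (s + 1)"]) (use free s in auto)
  note pg = bobs_turn_play[OF g]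
  have ears: "ear (s + 1) \<notin> colored h" "ear (s + 2) \<notin> colored h" "ear (s + 3) \<notin> colored h"
    using ear_uncolored[OF ph a0, of "s + 1"] ear_uncolored[OF ph a0, of "s + 2"]
      ear_uncolored[OF ph a0, of "s + 3"] free by (auto simp: numeral_eq_Suc)
  \<comment> \<open>Bob threatens to bring \<open>w\<close> next to \<open>rim (s + 1)\<close>. If
    Alice puts another colour on \<open>rim (s + 2)\<close>, he uses \<open>ear (s + 1)\<close>; if
    she puts \<open>w\<close> there, she carries out the threat herself. In the last case he plays
    \<open>w\<close> on \<open>rim (s + 2)\<close>.\<close>
  consider "v = rim (s + 1)" | "v = rim (s + 2)" "d \<noteq> w" | "v = rim (s + 2)" "d = w"
    | "v = rim (s + 3)" "d = w" | "v \<noteq> rim (s + 1)" "v \<noteq> rim (s + 2)" "v = rim (s + 3) \<Longrightarrow> d \<noteq> w"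
    by blast
  then show False
  proof cases
    case 1
    show False
      by (rule gap_3[OF g, of a "s + 1" d y]) (use 1 a y s free in \<open>auto simp: add.commute numeral_eq_Suc\<close>)
  next
    case 2
    show False
      by (rule bob_kills_ear[OF g, of "s + 1" a "rim s" x "ear s" z w "s + 1" "s + 2" d])
        (use 2 a x z w s free ears ax in auto)
  next
    case 3
    have "rim (s + 1) \<in> fan_V n" "rim (s + 1) \<notin> colored ?g" using 3 free s by auto
    then obtain k where k: "k < 4" "\<And>u. {u, rim (s + 1)} \<in> fan_E n \<Longrightarrow> (u, k) \<notin> set ?g"
      using free_color[OF pg] by blast
    have "k \<noteq> a" "k \<noteq> x" "k \<noteq> z" "k \<noteq> w"
      using k(2)[of 0] k(2)[of "rim s"] k(2)[of "ear s"] k(2)[of "rim (s + 2)"] 3 a x s by auto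
    then show False
      using four_colors[of a x z w k] k(1) w z ax play_color_less[OF ph a] play_color_less[OF ph x]
      by auto
  next
    case 4
    obtain r where r: "r < 4" "r \<notin> set [a, y, w]" by (rule avoid_colors[of "[a, y, w]" 4]) auto
    show False
      by (rule bob_kills_ear[OF g, of "s + 4" a "rim (s + 5)" y "rim (s + 3)" w r "s + 3" "s + 3" w])
        (use 4 a y w r s free ears ay in auto)
  next
    case 5
    have g0: "0 \<in> colored ?g" using a0 by simp
    \<comment> \<open>A reply at \<open>rim (s + 3)\<close> is not at an ear; after any other reply
      these ears have only uncoloured ends.\<close>
    have ears': "ear (s + 1) \<notin> colored ?g" "ear (s + 2) \<notin> colored ?g"
      using ear_uncolored[OF pg g0, of "s + 1"] ear_uncolored[OF pg g0, of "s + 2"] 5 free ears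
      by (cases "v = rim (s + 3)"; auto simp: numeral_eq_Suc)+
    show False
    proof (rule bob_kills[OF g, of "rim (s + 1)" "rim (s + 2)" 0 w])
      fix u assume "{u, rim (s + 2)} \<in> fan_E n"
      then show "(u, w) \<notin> set ?g"
      proof (rule rim_neighbour_free[rotated 3])
        show "(0, w) \<notin> set ?g" using play_unique[OF pg, of 0 a w] a w by auto
        show "(rim j, w) \<notin> set ?g" if "j = s + 2 + 1 \<or> s + 2 = j + 1" for j
          using that 5 free by (auto simp: colored_iff add.commute numeral_eq_Suc)
        show "(ear j, w) \<notin> set ?g" if "j = s + 2 \<or> s + 2 = j + 1" for j
          using that ears' by (auto simp: colored_iff add.commute numeral_eq_Suc)
      qed
    next
      fix k :: nat assume "k < 4" "k \<noteq> w"
      then have "k = a \<or> k = x \<or> k = z"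
        using four_colors[of a x z w k] w z ax play_color_less[OF ph a] play_color_less[OF ph x]
        by auto
      then show "\<exists>u. {u, rim (s + 1)} \<in> fan_E n \<and> (u, k) \<in> set ?g"
        using a x s by (elim disjE) (rule exI[of _ 0] exI[of _ "rim s"] exI[of _ "ear s"]; simp)+
    qed (use 5 a s w free in \<open>auto simp: colored_iff\<close>)
  qed
qed

text \<open>For longer gaps Bob plays two steps ahead of the end of the gap: Alice has to save the vertex
  in between, and the gap has become shorter by two.\<close>

lemma gap:
  assumes "bobs_turn h" "(0, a) \<in> set h" "t \<le> n" "s + 4 \<le> t"
    and "rim s \<in> colored h" "rim t \<in> colored h"
    and "\<And>i. s < i \<Longrightarrow> i < t \<Longrightarrow> rim i \<notin> colored h"
    and "t = s + 5 \<Longrightarrow> ear s \<notin> colored h"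
  shows False
  using assms
proof (induction "t - s" arbitrary: h s rule: less_induct)
  case less
  note h = less.prems(1) and a = less.prems(2) and free = less.prems(7)
  note ph = bobs_turn_play[OF h]
  have a0: "0 \<in> colored h" using a by (auto simp: colored_iff)
  obtain x y where x: "(rim s, x) \<in> set h" and y: "(rim t, y) \<in> set h"
    using less.prems by (auto simp: colored_iff)
  consider "t = s + 4" | "t = s + 5" | "s + 6 \<le> t" using less.prems(4) by linarith
  then show False
  proof cases
    case 1
    show False
      by (rule gap_3[OF h a _ x]) (use 1 y less.prems(3) free in auto)
  next
    case 2
    show False
      by (rule gap_4[OF h a _ x]) (use 2 y less.prems(3,8) free in auto)
  next
    case 3
    have free': "rim (s + 1) \<notin> colored h" "rim (s + 2) \<notin> colored h" "rim (s + 3) \<notin> colored h"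
      using free 3 by auto
    have ax: "a \<noteq> x" using play_proper[OF ph, of 0 "rim s" a] a x less.prems(3,4) by auto
    obtain z where z: "z < 4" "z \<notin> set [a, x]" by (rule avoid_colors[of "[a, x]" 4]) auto
    have p: "play ((rim (s + 2), z) # h)"
    proof (rule bob_rim[OF h a])
      show "rim j \<notin> colored h" if "j = s + 2 + 1 \<or> s + 2 = j + 1" for j
        using that free' by (auto simp: add.commute numeral_eq_Suc)
    qed (use z 3 less.prems(3) free' in auto)
    obtain v d where g: "bobs_turn ((v, d) # (rim (s + 2), z) # h)" (is "bobs_turn ?g")
      by (rule bob_round[OF h p, of "rim (s + 1)"]) (use free' 3 less.prems(3) in auto)
    have ears: "ear (s + 1) \<notin> colored h" "ear (s + 2) \<notin> colored h"
      using ear_uncolored[OF ph a0, of "s + 1"] ear_uncolored[OF ph a0, of "s + 2"] free'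
      by (auto simp: numeral_eq_Suc)
    show False
    \<comment> \<open>Both replies that save \<open>rim (s + 1)\<close> leave
      \<open>ear (s + 2)\<close> uncoloured, as needed when the remaining distance is five. As
      \<open>s + 6 \<le> t\<close>, that distance is at least four.\<close>
    proof (cases "v = rim (s + 1) \<or> v = ear (s + 1)")
      case True
      show False
        by (rule less.hyps[OF _ g]) (use True 3 less.prems ears in auto)
    next
      case False
      obtain w where w: "w < 4" "w \<notin> set [a, x, z]" by (rule avoid_colors[of "[a, x, z]" 4]) auto
      show False
        by (rule bob_kills_ear[OF g, of "s + 1" a "rim s" x "rim (s + 2)" z w "s + 1" "s + 2" z])
          (use False a x z w 3 less.prems(3) free' ears ax in auto)
    qed
  qed
qed

text \<open>Bob takes the middle of an untouched block of 19 rim vertices, then the outer end of a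
  half whose rim Alice's reply has spared. The ends of the resulting gap are at distance
  nine.\<close>

lemma four_colors_lose:
  assumes n: "94 \<le> n"
  shows False
proof -
  obtain h where h: "bobs_turn h" "0 \<in> colored h" "length h \<le> 5"
    using hub_reached n by auto
  obtain s where s: "s + 18 \<le> n" "\<And>i. s \<le> i \<Longrightarrow> i \<le> s + 18 \<Longrightarrow> rim i \<notin> colored h"
    using untouched_block[OF bobs_turn_play[OF h(1)] h(2,3) n] by blast
  obtain a where a: "(0, a) \<in> set h" using h(2) by (auto simp: colored_iff)
  obtain k where k: "k < 4" "k \<notin> set [a]" by (rule avoid_colors[of "[a]" 4]) auto
  have p: "play ((rim (s + 9), k) # h)"
  proof (rule bob_rim[OF h(1) a])
    show "rim j \<notin> colored h" if "j = s + 9 + 1 \<or> s + 9 = j + 1" for j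
      using that s(2)[of j] by auto
  qed (use k s in auto)
  obtain y d where yd: "legal ((rim (s + 9), k) # h) (y, d)"
    and g: "bobs_turn ((y, d) # (rim (s + 9), k) # h)" (is "bobs_turn ?g")
    by (rule bob_round[OF h(1) p, of "rim s"]) (use s(1) s(2)[of s] in auto)
  obtain l r t where lr: "s \<le> l" "r = l + 9" "r \<le> s + 18" "{t, s + 9} = {l, r}"
    and y: "\<And>i. l \<le> i \<Longrightarrow> i \<le> r \<Longrightarrow> y \<noteq> rim i"
  proof (cases "\<exists>i < s + 9. y = rim i")
    case True
    then show ?thesis by (intro that[of "s + 9" "s + 18" "s + 18"]) auto
  next
    case False
    moreover have "y \<noteq> rim (s + 9)" using yd by (auto simp: legal_coloring_def)
    ultimately have "y \<noteq> rim i" if "i \<le> s + 9" for i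
      using that by (cases "i = s + 9") auto
    then show ?thesis by (intro that[of s "s + 9" s]) auto
  qed
  have g_free: "rim i \<notin> colored ?g" if "l \<le> i" "i \<le> r" "i \<noteq> s + 9" for i
    using that s(2)[of i] lr y[of i] by auto
  have t: "l \<le> t" "t \<le> r" "t \<noteq> s + 9" "t \<le> n"
    using lr s(1) by (auto simp: doubleton_eq_iff)
  then have "rim t \<in> fan_V n" "rim t \<notin> colored ?g" using g_free by auto
  \<comment> \<open>\<open>rim t\<close> is at the border of the block and may have coloured
    neighbours, so its colour comes from \<open>free_color\<close>.\<close>
  then obtain c where c: "c < 4" "\<And>u. {u, rim t} \<in> fan_E n \<Longrightarrow> (u, c) \<notin> set ?g"
    using free_color[OF bobs_turn_play[OF g]] by blast
  have q: "play ((rim t, c) # ?g)"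
    by (rule bob_move[OF g _ _ _ _ c, where w = 0]) (use t g_free h(2) in auto)
  obtain v e where g2: "bobs_turn ((v, e) # (rim t, c) # ?g)" (is "bobs_turn ?g2")
    by (rule bob_round[OF g q, of "rim (l + 1)"])
      (use lr s(1) g_free[of "l + 1"] in \<open>auto simp: doubleton_eq_iff\<close>)
  have ends: "rim l \<in> colored ?g2" "rim r \<in> colored ?g2"
    using lr(4) by (auto simp: doubleton_eq_iff)
  have inner: "rim i \<notin> colored ?g2" if "l < i" "i < r" "v \<noteq> rim i" for i
    using that g_free[of i] lr(4) by (auto simp: doubleton_eq_iff)
  have a2: "(0, a) \<in> set ?g2" using a by simp
  have rn: "r \<le> n" using lr s(1) by simp
  note gap' = gap[OF g2 a2]
  show False
  proof (cases "\<exists>i. l < i \<and> i < r \<and> v = rim i")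
    case False
    then show False using gap'[OF rn _ ends] inner lr(2) by auto
  next
    case True
    then obtain i where i: "l < i" "i < r" "v = rim i" by blast
    then have iv: "rim i \<in> colored ?g2" by simp
    show False
    \<comment> \<open>For the listed offsets the right part has distance 8, 7, 6 or 4; otherwise the
      left part has distance 4, 6, 7 or 8. This avoids distance 5, for which \<open>gap\<close> asks
      for an uncoloured ear.\<close>
    proof (cases "i \<in> {l + 1, l + 2, l + 3, l + 5}")
      case True
      show False
        by (rule gap'[OF rn _ iv ends(2)]) (use True i lr(2) inner in auto)
    next
      case False
      show False
        by (rule gap'[OF _ _ ends(1) iv]) (use False i lr(2) rn inner in auto)
    qed
  qed
qed

end

section \<open>Both parameters equal five\<close>

lemma alice_loses_coloring_fan:
  assumes "m < 5" "94 \<le> n"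
  shows "\<not> alice_wins_coloring (fan_V n) (fan_E n) m"
proof
  assume "alice_wins_coloring (fan_V n) (fan_E n) m"
  then obtain \<sigma> where \<sigma>: "fan_game n m \<sigma>"
    unfolding alice_wins_coloring_def alice_can_guarantee_def
    using two_tree_imp_finite_simple_graph[OF two_tree_fan]
    by (metis alice_winning.intro fan_game.intro)
  show False
  proof (cases "m = 4")
    case True
    then show False using \<sigma> fan_game_4.four_colors_lose assms(2) by (simp add: fan_game_4_def)
  next
    case False
    then show False using fan_game.few_colors_lose[OF \<sigma>] assms by simp
  qed
qed

theorem theorem3p3:
  "\<exists>(V :: nat set) (E :: nat set set).
     finite_simple_graph V E \<and> two_tree V E \<and> outerplanar V E \<and>
     chi_cg V E = 5 \<and> col_cg V E = 5"
proof (intro exI conjI)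
  let ?V = "fan_V 94" and ?E = "fan_E 94"
  note conn = two_tree_connected[OF two_tree_fan]
  show "two_tree ?V ?E" by (rule two_tree_fan)
  then show "finite_simple_graph ?V ?E" by (rule two_tree_imp_finite_simple_graph)
  show "outerplanar ?V ?E" by (rule outerplanar_fan)
  \<comment> \<open>Each \<open>m < 5\<close> is excluded on its own; no monotonicity in the number
    of colours is used.\<close>
  have lower: "5 \<le> m" if "alice_wins_coloring ?V ?E m" for m
    using alice_loses_coloring_fan[of m 94] that by (cases "m < 5") auto
  show "chi_cg ?V ?E = 5"
    unfolding chi_cg_def
    using alice_wins_coloring_if_bounds_marking[OF conn alice_bounds_marking_fan] lower
    by (rule Least_equality)
  \<comment> \<open>A marking bound \<open>m\<close> would let Alice win with \<open>m\<close>
    colours, so the lower bound carries over.\<close>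
  show "col_cg ?V ?E = 5"
    unfolding col_cg_def
    using alice_bounds_marking_fan
    by (rule Least_equality) (rule lower[OF alice_wins_coloring_if_bounds_marking[OF conn]])
qed

end
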